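(* Let $(\mathfrak A,\alpha)$ and $(\mathfrak B,\beta)$ be involutive $\mathbb Z_2$-graded algebras, let $\omega$ be a state on $\mathfrak A$ and $\varphi$ a state on $\mathfrak B$, and suppose that $\omega$ or $\varphi$ is even. Then the product functional $\omega\times\varphi$ is positive on the algebraic Fermi tensor product $\mathfrak A\otimes_F\mathfrak B$. In addition, for any $x,y\in\mathfrak A\otimes_F\mathfrak B$ one has $$|(\omega\times\varphi)(x)|\le(\omega\times\varphi)(x^*x)^{1/2},\qquad (\omega\times\varphi)(x^*y^*yx)\le C_y\,(\omega\times\varphi)(x^*x),$$ where $C_y$ is a positive constant depending on $y$.
   Context: An involutive $\mathbb Z_2$-graded algebra is a pair $(\mathfrak A,\theta)$ with $\mathfrak A$ a complex $*$-algebra and $\theta$ a $*$-automorphism of $\mathfrak A$ with $\theta^2=\mathrm{id}$. Put $\mathfrak A_{\pm}=\{a\in\mathfrak A:\theta(a)=\pm a\}$, so that $\mathfrak A=\mathfrak A_+\dot+\mathfrak A_-$ (algebraic direct sum); elements of $\mathfrak A_\pm$ are called homogeneous, with grade $\partial(a)=\pm1$ for $a\in\mathfrak A_\pm$. A linear functional $f$ on a $*$-algebra is positive if $f(a^*a)\ge0$ for all $a$, and a functional $f$ on $(\mathfrak A,\theta)$ is even if $f\circ\theta=f$. The algebras are supposed unital (if needed, without loss of generality), and a state is a positive linear functional taking the value $1$ at the identity. For homogeneous $a,b$ (possibly in different algebras), $\epsilon(a,b)=-1$ if $\partial(a)=\partial(b)=-1$ and $\epsilon(a,b)=1$ otherwise.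 The algebraic Fermi tensor product $\mathfrak A\otimes_F\mathfrak B$ is the algebraic tensor product of the vector spaces $\mathfrak A$ and $\mathfrak B$, with product and involution obtained by bilinear (resp. antilinear) extension from $$(a\otimes_F b)(A\otimes_F B)=\epsilon(b,A)\,aA\otimes_F bB,\qquad (a\otimes_F b)^*=\epsilon(a,b)\,a^*\otimes_F b^*$$ for homogeneous $a,A\in\mathfrak A$, $b,B\in\mathfrak B$. The product functional $\omega\times\varphi$ is the linear functional on $\mathfrak A\otimes_F\mathfrak B$ given by $(\omega\times\varphi)\big(\sum_j a_j\otimes_F b_j\big)=\sum_j\omega(a_j)\varphi(b_j)$.
   Formalization: The bound with C_y is proved only when ω and φ each satisfy such a bound on their own algebra (automatic for C*-algebras); without this it fails, e.g. for polynomials in one selfadjoint variable with a state given by a measure of unbounded support. The condition is also necessary. *)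

theory Defs
  imports Complex_Main "HOL-Library.Poly_Mapping" "HOL-Library.Complex_Order"
begin

section \<open>Complex vector spaces and unital complex *-algebras\<close>

class scaleC =
  fixes scaleC :: "complex \<Rightarrow> 'a \<Rightarrow> 'a"  (infixr \<open>*\<^sub>C\<close> 75)

class complex_vector = scaleC + ab_group_add +
  assumes scaleC_add_right: "c *\<^sub>C (x + y) = c *\<^sub>C x + c *\<^sub>C y"
    and scaleC_add_left: "(c + d) *\<^sub>C x = c *\<^sub>C x + d *\<^sub>C x"
    and scaleC_scaleC: "c *\<^sub>C (d *\<^sub>C x) = (c * d) *\<^sub>C x"
    and scaleC_one: "1 *\<^sub>C x = x"

global_interpretation cvec: vector_space "scaleC :: complex \<Rightarrow> 'a \<Rightarrow> 'a::complex_vector"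
  by unfold_locales (simp_all add: scaleC_add_right scaleC_add_left scaleC_scaleC scaleC_one)

text \<open>The axiom \<open>0 \<noteq> 1\<close> of \<^class>\<open>ring_1\<close> only excludes the zero algebra, which has no states.\<close>

class complex_star_algebra = complex_vector + ring_1 +
  fixes star :: "'a \<Rightarrow> 'a"
  assumes scaleC_mult_left: "(c *\<^sub>C x) * y = c *\<^sub>C (x * y)"
    and scaleC_mult_right: "x * (c *\<^sub>C y) = c *\<^sub>C (x * y)"
    and star_add: "star (x + y) = star x + star y"
    and star_scaleC: "star (c *\<^sub>C x) = cnj c *\<^sub>C star x"
    and star_mult: "star (x * y) = star y * star x"
    and star_star: "star (star x) = x"


section \<open>Gradings and functionals\<close>

definition star_automorphism :: "('a::complex_star_algebra \<Rightarrow> 'a) \<Rightarrow> bool" where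
  "star_automorphism \<theta> \<longleftrightarrow>
     Vector_Spaces.linear scaleC scaleC \<theta> \<and> bij \<theta> \<and>
     (\<forall>x y. \<theta> (x * y) = \<theta> x * \<theta> y) \<and> (\<forall>x. \<theta> (star x) = star (\<theta> x))"

definition z2_grading :: "('a::complex_star_algebra \<Rightarrow> 'a) \<Rightarrow> bool" where
  "z2_grading \<theta> \<longleftrightarrow> star_automorphism \<theta> \<and> \<theta> \<circ> \<theta> = id"

text \<open>
  \<open>has_grade \<theta> s a\<close> says that \<open>a\<close> is homogeneous of grade \<open>s\<close>, and \<open>grade_part \<theta> s a\<close> is the
  component of grade \<open>s\<close> of an arbitrary \<open>a\<close>; both are meant for \<open>s \<in> {1, -1}\<close>.
\<close>

definition has_grade :: "('a::complex_star_algebra \<Rightarrow> 'a) \<Rightarrow> int \<Rightarrow> 'a \<Rightarrow> bool" where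
  "has_grade \<theta> s a \<longleftrightarrow> \<theta> a = of_int s *\<^sub>C a"

definition grade_part :: "('a::complex_star_algebra \<Rightarrow> 'a) \<Rightarrow> int \<Rightarrow> 'a \<Rightarrow> 'a" where
  "grade_part \<theta> s a = (1 / 2) *\<^sub>C (a + of_int s *\<^sub>C \<theta> a)"

definition fermi_sign :: "int \<Rightarrow> int \<Rightarrow> complex" where
  "fermi_sign s t = (if s = -1 \<and> t = -1 then -1 else 1)"

definition even_functional :: "('a \<Rightarrow> 'a) \<Rightarrow> ('a \<Rightarrow> complex) \<Rightarrow> bool" where
  "even_functional \<theta> f \<longleftrightarrow> f \<circ> \<theta> = f"

text \<open>
  Product and involution are arguments here, because those of the Fermi tensor product depend on
  the two gradings. The order on \<^typ>\<open>complex\<close> is that of \<^theory>\<open>HOL-Library.Complex_Order\<close>: \<open>0 \<le> z\<close>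
  means that \<open>z\<close> is real and nonnegative.
\<close>

definition positive_functional ::
    "('a \<Rightarrow> 'a \<Rightarrow> 'a) \<Rightarrow> ('a \<Rightarrow> 'a) \<Rightarrow> ('a::complex_vector \<Rightarrow> complex) \<Rightarrow> bool" where
  "positive_functional mul st f \<longleftrightarrow>
     Vector_Spaces.linear scaleC (*) f \<and> (\<forall>a. 0 \<le> f (mul (st a) a))"

definition state :: "('a::complex_star_algebra \<Rightarrow> complex) \<Rightarrow> bool" where
  "state f \<longleftrightarrow> positive_functional (*) star f \<and> f 1 = 1"

text \<open>
  Left multiplications act by bounded operators on the GNS space of \<open>f\<close>. Every positive functional
  on a C*-algebra has this property, with \<open>C = \<parallel>y\<parallel>\<^sup>2\<close> (or \<open>C = 1\<close> if \<open>y = 0\<close>), but a state on a mere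
  *-algebra need not have it: on the polynomials in one selfadjoint variable, take integration
  against a probability measure with unbounded support and finite moments. An estimate
  \<open>(\<omega> \<times> \<phi>)(x\<^sup>* y\<^sup>* y x) \<le> C\<^sub>y (\<omega> \<times> \<phi>)(x\<^sup>* x)\<close> for a product functional implies it for both factors
  (restrict \<open>x\<close> and \<open>y\<close> to one factor), so that it has to be assumed for such an estimate.
\<close>

definition gns_bounded :: "('a::complex_star_algebra \<Rightarrow> complex) \<Rightarrow> bool" where
  "gns_bounded f \<longleftrightarrow>
     (\<forall>y. \<exists>C>0. \<forall>x. f (star x * star y * y * x) \<le> complex_of_real C * f (star x * x))"


section \<open>The algebraic tensor product of two complex vector spaces\<close>

text \<open>
  The free vector space on \<open>'a \<times> 'b\<close>, consisting of the finitely supported functions, modulo the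
  subspace spanned by the bilinearity relations.
\<close>

definition free_scale :: "complex \<Rightarrow> ('x \<Rightarrow>\<^sub>0 complex) \<Rightarrow> ('x \<Rightarrow>\<^sub>0 complex)" where
  "free_scale c = Poly_Mapping.map ((*) c)"

lemma lookup_free_scale: "Poly_Mapping.lookup (free_scale c p) k = c * Poly_Mapping.lookup p k"
  unfolding free_scale_def by transfer (simp add: when_def)

lemma free_scale_single:
  "free_scale c (Poly_Mapping.single k d) = Poly_Mapping.single k (c * d)"
  by (rule poly_mapping_eqI) (simp add: lookup_free_scale lookup_single when_def)

global_interpretation free: vector_space "free_scale :: complex \<Rightarrow> ('x \<Rightarrow>\<^sub>0 complex) \<Rightarrow> _"
  by unfold_locales (rule poly_mapping_eqI; simp add: lookup_free_scale lookup_add algebra_simps)+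

inductive_set tensor_relations :: "('a::complex_vector \<times> 'b::complex_vector \<Rightarrow>\<^sub>0 complex) set" where
  add_left: "Poly_Mapping.single (a + a', b) 1 - Poly_Mapping.single (a, b) 1
    - Poly_Mapping.single (a', b) 1 \<in> tensor_relations"
| add_right: "Poly_Mapping.single (a, b + b') 1 - Poly_Mapping.single (a, b) 1
    - Poly_Mapping.single (a, b') 1 \<in> tensor_relations"
| scale_left: "Poly_Mapping.single (c *\<^sub>C a, b) 1 - free_scale c (Poly_Mapping.single (a, b) 1)
    \<in> tensor_relations"
| scale_right: "Poly_Mapping.single (a, c *\<^sub>C b) 1 - free_scale c (Poly_Mapping.single (a, b) 1)
    \<in> tensor_relations"

definition tensor_eq :: "('a::complex_vector \<times> 'b::complex_vector \<Rightarrow>\<^sub>0 complex) \<Rightarrow>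
    ('a \<times> 'b \<Rightarrow>\<^sub>0 complex) \<Rightarrow> bool" where
  "tensor_eq p q \<longleftrightarrow> p - q \<in> free.span tensor_relations"

lemma equivp_tensor_eq:
  "equivp (tensor_eq :: ('a::complex_vector \<times> 'b::complex_vector \<Rightarrow>\<^sub>0 complex) \<Rightarrow> _)"
proof (rule equivpI)
  show "reflp (tensor_eq :: ('a \<times> 'b \<Rightarrow>\<^sub>0 complex) \<Rightarrow> _)"
    by (auto intro!: reflpI simp: tensor_eq_def free.span_zero)
  show "symp (tensor_eq :: ('a \<times> 'b \<Rightarrow>\<^sub>0 complex) \<Rightarrow> _)"
    by (rule sympI) (use free.span_neg in \<open>fastforce simp: tensor_eq_def\<close>)
  show "transp (tensor_eq :: ('a \<times> 'b \<Rightarrow>\<^sub>0 complex) \<Rightarrow> _)"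
  proof (rule transpI)
    fix p q r :: "('a \<times> 'b \<Rightarrow>\<^sub>0 complex)"
    assume "tensor_eq p q" "tensor_eq q r"
    then have "(p - q) + (q - r) \<in> free.span tensor_relations"
      unfolding tensor_eq_def by (rule free.span_add)
    then show "tensor_eq p r" by (simp add: tensor_eq_def)
  qed
qed

quotient_type (overloaded) ('a, 'b) tensor =
    "('a::complex_vector \<times> 'b::complex_vector) \<Rightarrow>\<^sub>0 complex" / tensor_eq
  by (rule equivp_tensor_eq)

instantiation tensor :: (complex_vector, complex_vector) complex_vector
begin

lift_definition zero_tensor :: "('a, 'b) tensor" is 0 .

lift_definition plus_tensor :: "('a, 'b) tensor \<Rightarrow> ('a, 'b) tensor \<Rightarrow> ('a, 'b) tensor" is "(+)"
  unfolding tensor_eq_def by (simp add: add_diff_add free.span_add)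

lift_definition uminus_tensor :: "('a, 'b) tensor \<Rightarrow> ('a, 'b) tensor" is uminus
  unfolding tensor_eq_def by (simp only: minus_diff_minus free.span_neg)

lift_definition minus_tensor :: "('a, 'b) tensor \<Rightarrow> ('a, 'b) tensor \<Rightarrow> ('a, 'b) tensor" is "(-)"
  unfolding tensor_eq_def
proof -
  fix p p' q q' :: "('a \<times> 'b) \<Rightarrow>\<^sub>0 complex"
  assume "p - p' \<in> free.span tensor_relations" "q - q' \<in> free.span tensor_relations"
  then have "(p - p') - (q - q') \<in> free.span tensor_relations" by (rule free.span_diff)
  then show "(p - q) - (p' - q') \<in> free.span tensor_relations" by (simp add: algebra_simps)
qed

lift_definition scaleC_tensor :: "complex \<Rightarrow> ('a, 'b) tensor \<Rightarrow> ('a, 'b) tensor" is free_scale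
  unfolding tensor_eq_def by (simp add: free.span_scale flip: free.scale_right_diff_distrib)

instance
proof
  fix x y z :: "('a, 'b) tensor" and c d :: complex
  have eq: "tensor_eq p q" if "p = q" for p q :: "('a \<times> 'b) \<Rightarrow>\<^sub>0 complex"
    using that by (simp add: tensor_eq_def free.span_zero)
  show "x + y + z = x + (y + z)" by transfer (rule eq, simp add: add.assoc)
  show "x + y = y + x" by transfer (rule eq, simp add: add.commute)
  show "0 + x = x" by transfer (rule eq, simp)
  show "- x + x = 0" by transfer (rule eq, simp)
  show "x - y = x + - y" by transfer (rule eq, simp)
  show "c *\<^sub>C (x + y) = c *\<^sub>C x + c *\<^sub>C y"
    by transfer (rule eq, rule free.scale_right_distrib)
  show "(c + d) *\<^sub>C x = c *\<^sub>C x + d *\<^sub>C x"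
    by transfer (rule eq, rule free.scale_left_distrib)
  show "c *\<^sub>C d *\<^sub>C x = (c * d) *\<^sub>C x"
    by transfer (rule eq, rule free.scale_scale)
  show "1 *\<^sub>C x = x" by transfer (rule eq, rule free.scale_one)
qed

end

lift_definition tensor_prod :: "'a::complex_vector \<Rightarrow> 'b::complex_vector \<Rightarrow> ('a, 'b) tensor"
  (infixr \<open>\<otimes>\<^sub>F\<close> 72) is "\<lambda>a b. Poly_Mapping.single (a, b) 1" .

lemma tensor_add_left: "(a + a') \<otimes>\<^sub>F b = a \<otimes>\<^sub>F b + a' \<otimes>\<^sub>F b"
  by transfer (use free.span_base[OF tensor_relations.add_left] in \<open>simp add: tensor_eq_def diff_diff_add\<close>)

lemma tensor_add_right: "a \<otimes>\<^sub>F (b + b') = a \<otimes>\<^sub>F b + a \<otimes>\<^sub>F b'"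
  by transfer (use free.span_base[OF tensor_relations.add_right] in \<open>simp add: tensor_eq_def diff_diff_add\<close>)

lemma tensor_scale_left: "(c *\<^sub>C a) \<otimes>\<^sub>F b = c *\<^sub>C (a \<otimes>\<^sub>F b)"
  by transfer (simp add: tensor_eq_def free.span_base tensor_relations.scale_left)

lemma tensor_scale_right: "a \<otimes>\<^sub>F (c *\<^sub>C b) = c *\<^sub>C (a \<otimes>\<^sub>F b)"
  by transfer (simp add: tensor_eq_def free.span_base tensor_relations.scale_right)

text \<open>
  Every tensor is a sum of elementary ones (scalars can be absorbed into the first factor), so a
  biadditive map \<open>f\<close> with \<open>f (c a) b = f a (c b)\<close> extends uniquely to an additive map on the tensor
  product. This covers linear and antilinear extension alike. For other \<open>f\<close> the value of
  \<open>tensor_ext f\<close> depends on the choice of representatives.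
\<close>

definition balanced :: "('a::complex_vector \<Rightarrow> 'b::complex_vector \<Rightarrow> 'c::ab_group_add) \<Rightarrow> bool" where
  "balanced f \<longleftrightarrow> (\<forall>a a' b. f (a + a') b = f a b + f a' b) \<and>
     (\<forall>a b b'. f a (b + b') = f a b + f a b') \<and> (\<forall>c a b. f (c *\<^sub>C a) b = f a (c *\<^sub>C b))"

definition free_ext ::
    "('a::complex_vector \<Rightarrow> 'b \<Rightarrow> 'c::ab_group_add) \<Rightarrow> ('a \<times> 'b \<Rightarrow>\<^sub>0 complex) \<Rightarrow> 'c" where
  "free_ext f p = (\<Sum>k\<in>Poly_Mapping.keys p. f (Poly_Mapping.lookup p k *\<^sub>C fst k) (snd k))"

definition tensor_ext ::
    "('a::complex_vector \<Rightarrow> 'b::complex_vector \<Rightarrow> 'c::ab_group_add) \<Rightarrow> ('a, 'b) tensor \<Rightarrow> 'c" where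
  "tensor_ext f x = free_ext f (rep_tensor x)"

context
  fixes f :: "'a::complex_vector \<Rightarrow> 'b::complex_vector \<Rightarrow> 'c::ab_group_add"
  assumes bal: "balanced f"
begin

lemma balanced_zero_left: "f 0 b = 0"
proof -
  have "f (0 + 0) b = f 0 b + f 0 b" using bal unfolding balanced_def by blast
  then show ?thesis by simp
qed

lemma free_ext_superset:
  assumes "finite S" "Poly_Mapping.keys p \<subseteq> S"
  shows "free_ext f p = (\<Sum>k\<in>S. f (Poly_Mapping.lookup p k *\<^sub>C fst k) (snd k))"
  unfolding free_ext_def
  by (rule sum.mono_neutral_left) (use assms in \<open>auto simp: in_keys_iff balanced_zero_left\<close>)

lemma free_ext_add: "free_ext f (p + q) = free_ext f p + free_ext f q"
proof -
  let ?S = "Poly_Mapping.keys p \<union> Poly_Mapping.keys q"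
  have "f (Poly_Mapping.lookup (p + q) k *\<^sub>C fst k) (snd k)
      = f (Poly_Mapping.lookup p k *\<^sub>C fst k) (snd k) + f (Poly_Mapping.lookup q k *\<^sub>C fst k) (snd k)" for k
    using bal by (simp add: lookup_add scaleC_add_left balanced_def)
  then show ?thesis
    using free_ext_superset[of ?S p] free_ext_superset[of ?S q] free_ext_superset[of ?S "p + q"]
      Poly_Mapping.keys_add[of p q]
    by (simp add: sum.distrib)
qed

lemma free_ext_zero: "free_ext f 0 = 0"
  by (simp add: free_ext_def)

lemma free_ext_diff: "free_ext f (p - q) = free_ext f p - free_ext f q"
  using free_ext_add[of "p - q" q] by simp

lemma free_ext_single: "free_ext f (Poly_Mapping.single (a, b) c) = f (c *\<^sub>C a) b"
  by (simp add: free_ext_def balanced_zero_left)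

lemma free_ext_relation:
  assumes "p \<in> tensor_relations"
  shows "free_ext f (free_scale c p) = 0"
  using assms bal
  by cases (simp_all add: free.scale_right_diff_distrib free_ext_diff free_scale_single
      free_ext_single balanced_def scaleC_add_right scaleC_scaleC mult.commute)

lemma free_ext_span:
  assumes "p \<in> free.span tensor_relations"
  shows "free_ext f p = 0"
proof -
  have "\<forall>c. free_ext f (free_scale c p) = 0"
    using assms
  proof (induction rule: free.span_induct_alt)
    case base
    then show ?case by (simp add: free_ext_zero)
  next
    case (step c x y)
    then show ?case by (simp add: free.scale_right_distrib free_ext_add free_ext_relation)
  qed
  then show ?thesis by (metis free.scale_one)
qed

lemma tensor_ext_abs: "tensor_ext f (abs_tensor p) = free_ext f p"
proof -
  have "tensor_eq (rep_tensor (abs_tensor p)) p"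
    using Quotient3_rep_abs[OF Quotient3_tensor] by (simp add: tensor_eq_def free.span_zero)
  then have "free_ext f (rep_tensor (abs_tensor p) - p) = 0"
    unfolding tensor_eq_def by (rule free_ext_span)
  then show ?thesis
    by (simp add: tensor_ext_def free_ext_diff)
qed

lemma tensor_ext_tensor: "tensor_ext f (a \<otimes>\<^sub>F b) = f a b"
  by (simp add: tensor_prod.abs_eq tensor_ext_abs free_ext_single scaleC_one)

lemma tensor_ext_add: "tensor_ext f (x + y) = tensor_ext f x + tensor_ext f y"
proof (induction x rule: tensor.abs_induct)
  case (1 p)
  show ?case
  proof (induction y rule: tensor.abs_induct)
    case (1 q)
    show ?case by (simp add: plus_tensor.abs_eq tensor_ext_abs free_ext_add)
  qed
qed

end

lemma tensor_ext_plus: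
  "tensor_ext (\<lambda>a b. f a b + g a b) x = tensor_ext f x + tensor_ext g x"
  by (simp add: tensor_ext_def free_ext_def sum.distrib)

lemma tensor_induct [case_names tensor add]:
  fixes x :: "('a::complex_vector, 'b::complex_vector) tensor"
  assumes tensor: "\<And>a b. P (a \<otimes>\<^sub>F b)" and add: "\<And>x y. P x \<Longrightarrow> P y \<Longrightarrow> P (x + y)"
  shows "P x"
proof (induction x rule: tensor.abs_induct)
  case (1 p)
  show ?case
  proof (induction p rule: update_induct)
    case const
    have "abs_tensor 0 = (0 :: ('a, 'b) tensor)"
      by (simp add: zero_tensor_def)
    also have "\<dots> = (0 :: 'a) \<otimes>\<^sub>F (0 :: 'b)"
      using tensor_scale_left[of 0 "0 :: 'a" "0 :: 'b"] by simp
    finally show ?case using tensor[of 0 0] by simp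
  next
    case (update p k c)
    obtain a b where k: "k = (a, b)" by (cases k)
    have "Poly_Mapping.update k c p = p + Poly_Mapping.single k c"
      by (rule poly_mapping_eqI)
        (use update.hyps in \<open>auto simp: lookup_update lookup_add lookup_single in_keys_iff when_def\<close>)
    also have "\<dots> = p + free_scale c (Poly_Mapping.single k 1)"
      by (simp add: free_scale_single)
    finally have "abs_tensor (Poly_Mapping.update k c p) = abs_tensor p + c *\<^sub>C (a \<otimes>\<^sub>F b)"
      by (simp add: plus_tensor.abs_eq scaleC_tensor.abs_eq tensor_prod.abs_eq k)
    then show ?case
      using add[OF update.IH tensor[of "c *\<^sub>C a" b]] by (simp add: tensor_scale_left)
  qed
qed


section \<open>The Fermi tensor product\<close>

text \<open>
  The defining rules for homogeneous elements, written for arbitrary elementary tensors by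
  decomposing the factors whose grades enter the sign. They are recovered in
  \<open>fermi_mult_homogeneous\<close> and \<open>fermi_star_homogeneous\<close>.
\<close>

definition fermi_mult :: "('a::complex_star_algebra \<Rightarrow> 'a) \<Rightarrow> ('b::complex_star_algebra \<Rightarrow> 'b) \<Rightarrow>
    ('a, 'b) tensor \<Rightarrow> ('a, 'b) tensor \<Rightarrow> ('a, 'b) tensor" where
  "fermi_mult \<alpha> \<beta> x y =
     tensor_ext (\<lambda>a b. tensor_ext (\<lambda>A B.
       \<Sum>s\<in>{1, -1}. \<Sum>t\<in>{1, -1}.
         fermi_sign s t *\<^sub>C ((a * grade_part \<alpha> t A) \<otimes>\<^sub>F (grade_part \<beta> s b * B))) y) x"

definition fermi_star :: "('a::complex_star_algebra \<Rightarrow> 'a) \<Rightarrow> ('b::complex_star_algebra \<Rightarrow> 'b) \<Rightarrow>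
    ('a, 'b) tensor \<Rightarrow> ('a, 'b) tensor" where
  "fermi_star \<alpha> \<beta> =
     tensor_ext (\<lambda>a b. \<Sum>s\<in>{1, -1}. \<Sum>t\<in>{1, -1}.
       fermi_sign s t *\<^sub>C (star (grade_part \<alpha> s a) \<otimes>\<^sub>F star (grade_part \<beta> t b)))"

lemma z2_gradingD:
  assumes "z2_grading \<theta>"
  shows "\<theta> (x + y) = \<theta> x + \<theta> y" "\<theta> (c *\<^sub>C x) = c *\<^sub>C \<theta> x" "\<theta> (x * y) = \<theta> x * \<theta> y"
    "\<theta> (star x) = star (\<theta> x)" "\<theta> (\<theta> x) = x"
proof -
  have lin: "Vector_Spaces.linear scaleC scaleC \<theta>"
    using assms by (simp add: z2_grading_def star_automorphism_def)
  interpret \<theta>: Vector_Spaces.linear scaleC scaleC \<theta> by (rule lin)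
  show "\<theta> (x + y) = \<theta> x + \<theta> y" by (rule \<theta>.add)
  show "\<theta> (c *\<^sub>C x) = c *\<^sub>C \<theta> x" by (rule \<theta>.scale)
  show "\<theta> (x * y) = \<theta> x * \<theta> y" "\<theta> (star x) = star (\<theta> x)"
    using assms by (simp_all add: z2_grading_def star_automorphism_def)
  show "\<theta> (\<theta> x) = x"
    using assms by (simp add: z2_grading_def fun_eq_iff)
qed

lemma grade_part_add:
  "z2_grading \<theta> \<Longrightarrow> grade_part \<theta> s (x + y) = grade_part \<theta> s x + grade_part \<theta> s y"
  by (simp add: grade_part_def z2_gradingD scaleC_add_right algebra_simps)

lemma grade_part_scale:
  "z2_grading \<theta> \<Longrightarrow> grade_part \<theta> s (c *\<^sub>C x) = c *\<^sub>C grade_part \<theta> s x"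
  by (simp add: grade_part_def z2_gradingD scaleC_add_right scaleC_scaleC mult.commute)

lemma scaleC_half_double: "(1 / 2) *\<^sub>C (x + x) = (x :: 'a::complex_vector)"
proof -
  have "x + x = 2 *\<^sub>C x"
    using scaleC_add_left[of 1 1 x] by (simp add: scaleC_one)
  then show ?thesis by (simp add: scaleC_scaleC)
qed

lemma grade_part_homogeneous:
  assumes "s \<in> {1, -1}" "t \<in> {1, -1}" "has_grade \<theta> t x"
  shows "grade_part \<theta> s x = (if s = t then x else 0)"
  using assms by (auto simp: grade_part_def has_grade_def scaleC_half_double)

lemma grade_part_has_grade:
  "z2_grading \<theta> \<Longrightarrow> s \<in> {1, -1} \<Longrightarrow> has_grade \<theta> s (grade_part \<theta> s x)"
  by (auto simp: grade_part_def has_grade_def z2_gradingD scaleC_add_right scaleC_scaleC add.commute)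

lemma grade_part_sum: "grade_part \<theta> 1 x + grade_part \<theta> (-1) x = x"
  by (simp add: grade_part_def scaleC_half_double flip: scaleC_add_right)

lemma tensor_zero: "0 \<otimes>\<^sub>F b = 0" "a \<otimes>\<^sub>F 0 = 0"
  using tensor_add_left[of 0 0 b] tensor_add_right[of a 0 0] by simp_all

lemma star_zero: "star 0 = 0"
  using star_add[of 0 0] by simp

lemma balanced_sum:
  assumes "\<And>i. i \<in> S \<Longrightarrow> balanced (f i)"
  shows "balanced (\<lambda>a b. \<Sum>i\<in>S. f i a b)"
  using assms unfolding balanced_def by (simp add: sum.distrib cong: sum.cong)

lemma fermi_mult_tensor_add:
  assumes \<alpha>: "z2_grading \<alpha>" and \<beta>: "z2_grading \<beta>"
  shows fermi_mult_tensor: "fermi_mult \<alpha> \<beta> (a \<otimes>\<^sub>F b) (A \<otimes>\<^sub>F B) =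
      (\<Sum>s\<in>{1, -1}. \<Sum>t\<in>{1, -1}.
         fermi_sign s t *\<^sub>C ((a * grade_part \<alpha> t A) \<otimes>\<^sub>F (grade_part \<beta> s b * B)))"
    and fermi_mult_add_left: "fermi_mult \<alpha> \<beta> (x + x') y = fermi_mult \<alpha> \<beta> x y + fermi_mult \<alpha> \<beta> x' y"
    and fermi_mult_add_right: "fermi_mult \<alpha> \<beta> x (y + y') = fermi_mult \<alpha> \<beta> x y + fermi_mult \<alpha> \<beta> x y'"
proof -
  define T where "T s t a b A B =
    fermi_sign s t *\<^sub>C ((a * grade_part \<alpha> t A) \<otimes>\<^sub>F (grade_part \<beta> s b * B))" for s t a b A B
  define G where "G a b A B = (\<Sum>s\<in>{1, -1}. \<Sum>t\<in>{1, -1}. T s t a b A B)" for a b A B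
  have "balanced (T s t a b)" for s t a b
    by (simp add: balanced_def T_def grade_part_add[OF \<alpha>] grade_part_scale[OF \<alpha>] distrib_left
        scaleC_mult_right tensor_add_left tensor_add_right tensor_scale_left tensor_scale_right
        scaleC_add_right)
  then have inner: "balanced (G a b)" for a b
    unfolding G_def by (intro balanced_sum)
  have "T s t (a + a') b A B = T s t a b A B + T s t a' b A B" for s t a a' b A B
    by (simp add: T_def distrib_right tensor_add_left scaleC_add_right)
  then have 1: "G (a + a') b = (\<lambda>A B. G a b A B + G a' b A B)" for a a' b
    by (intro ext) (simp only: G_def sum.distrib)
  have "T s t a (b + b') A B = T s t a b A B + T s t a b' A B" for s t a b b' A B
    by (simp add: T_def grade_part_add[OF \<beta>] distrib_right tensor_add_right scaleC_add_right)
  then have 2: "G a (b + b') = (\<lambda>A B. G a b A B + G a b' A B)" for a b b'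
    by (intro ext) (simp only: G_def sum.distrib)
  have "T s t (c *\<^sub>C a) b A B = T s t a (c *\<^sub>C b) A B" for s t c a b A B
    by (simp add: T_def grade_part_scale[OF \<beta>] scaleC_mult_left tensor_scale_left tensor_scale_right)
  then have 3: "G (c *\<^sub>C a) b = G a (c *\<^sub>C b)" for c a b
    by (intro ext) (simp only: G_def)
  have outer: "balanced (\<lambda>a b. tensor_ext (G a b) y)" for y
    unfolding balanced_def by (simp add: 1 2 3 tensor_ext_plus)
  have "fermi_mult \<alpha> \<beta> (a \<otimes>\<^sub>F b) (A \<otimes>\<^sub>F B) = G a b A B"
    unfolding fermi_mult_def T_def[symmetric] G_def[symmetric]
    by (rule trans[OF tensor_ext_tensor[OF outer] tensor_ext_tensor[OF inner]])
  then show "fermi_mult \<alpha> \<beta> (a \<otimes>\<^sub>F b) (A \<otimes>\<^sub>F B) = (\<Sum>s\<in>{1, -1}. \<Sum>t\<in>{1, -1}.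
         fermi_sign s t *\<^sub>C ((a * grade_part \<alpha> t A) \<otimes>\<^sub>F (grade_part \<beta> s b * B)))"
    by (simp only: G_def T_def)
  have mult: "fermi_mult \<alpha> \<beta> x y = tensor_ext (\<lambda>a b. tensor_ext (G a b) y) x" for x y
    unfolding fermi_mult_def T_def[symmetric] G_def[symmetric] ..
  show "fermi_mult \<alpha> \<beta> (x + x') y = fermi_mult \<alpha> \<beta> x y + fermi_mult \<alpha> \<beta> x' y"
    unfolding mult by (rule tensor_ext_add[OF outer])
  show "fermi_mult \<alpha> \<beta> x (y + y') = fermi_mult \<alpha> \<beta> x y + fermi_mult \<alpha> \<beta> x y'"
    unfolding mult by (simp only: tensor_ext_add[OF inner] tensor_ext_plus)
qed

lemma fermi_mult_homogeneous:
  assumes "z2_grading \<alpha>" "z2_grading \<beta>" "s \<in> {1, -1}" "t \<in> {1, -1}"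
    and "has_grade \<beta> s b" "has_grade \<alpha> t A"
  shows "fermi_mult \<alpha> \<beta> (a \<otimes>\<^sub>F b) (A \<otimes>\<^sub>F B) = fermi_sign s t *\<^sub>C ((a * A) \<otimes>\<^sub>F (b * B))"
proof -
  have "grade_part \<alpha> t' A = (if t' = t then A else 0)" if "t' \<in> {1, -1}" for t'
    using that assms by (intro grade_part_homogeneous)
  moreover have "grade_part \<beta> s' b = (if s' = s then b else 0)" if "s' \<in> {1, -1}" for s'
    using that assms by (intro grade_part_homogeneous)
  ultimately show ?thesis
    unfolding fermi_mult_tensor[OF assms(1,2)] using assms(3,4) by (auto simp: tensor_zero)
qed

lemma fermi_star_tensor_add:
  assumes \<alpha>: "z2_grading \<alpha>" and \<beta>: "z2_grading \<beta>"
  shows fermi_star_tensor: "fermi_star \<alpha> \<beta> (a \<otimes>\<^sub>F b) = (\<Sum>s\<in>{1, -1}. \<Sum>t\<in>{1, -1}.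
      fermi_sign s t *\<^sub>C (star (grade_part \<alpha> s a) \<otimes>\<^sub>F star (grade_part \<beta> t b)))"
    and fermi_star_add: "fermi_star \<alpha> \<beta> (x + y) = fermi_star \<alpha> \<beta> x + fermi_star \<alpha> \<beta> y"
proof -
  have "balanced (\<lambda>a b. fermi_sign s t *\<^sub>C (star (grade_part \<alpha> s a) \<otimes>\<^sub>F star (grade_part \<beta> t b)))" for s t
    by (simp add: balanced_def grade_part_add[OF \<alpha>] grade_part_scale[OF \<alpha>] grade_part_add[OF \<beta>]
        grade_part_scale[OF \<beta>] star_add star_scaleC tensor_add_left tensor_add_right
        tensor_scale_left tensor_scale_right scaleC_add_right)
  then have bal: "balanced (\<lambda>a b. \<Sum>s\<in>{1, -1}. \<Sum>t\<in>{1, -1}.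
      fermi_sign s t *\<^sub>C (star (grade_part \<alpha> s a) \<otimes>\<^sub>F star (grade_part \<beta> t b)))"
    by (intro balanced_sum)
  show "fermi_star \<alpha> \<beta> (a \<otimes>\<^sub>F b) = (\<Sum>s\<in>{1, -1}. \<Sum>t\<in>{1, -1}.
      fermi_sign s t *\<^sub>C (star (grade_part \<alpha> s a) \<otimes>\<^sub>F star (grade_part \<beta> t b)))"
    unfolding fermi_star_def by (rule tensor_ext_tensor[OF bal])
  show "fermi_star \<alpha> \<beta> (x + y) = fermi_star \<alpha> \<beta> x + fermi_star \<alpha> \<beta> y"
    unfolding fermi_star_def by (rule tensor_ext_add[OF bal])
qed

lemma fermi_star_homogeneous:
  assumes "z2_grading \<alpha>" "z2_grading \<beta>" "s \<in> {1, -1}" "t \<in> {1, -1}"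
    and "has_grade \<alpha> s a" "has_grade \<beta> t b"
  shows "fermi_star \<alpha> \<beta> (a \<otimes>\<^sub>F b) = fermi_sign s t *\<^sub>C (star a \<otimes>\<^sub>F star b)"
proof -
  have "grade_part \<alpha> s' a = (if s' = s then a else 0)" if "s' \<in> {1, -1}" for s'
    using that assms by (intro grade_part_homogeneous)
  moreover have "grade_part \<beta> t' b = (if t' = t then b else 0)" if "t' \<in> {1, -1}" for t'
    using that assms by (intro grade_part_homogeneous)
  ultimately show ?thesis
    unfolding fermi_star_tensor[OF assms(1,2)] using assms(3,4) by (auto simp: tensor_zero star_zero)
qed

definition product_functional ::
    "('a::complex_vector \<Rightarrow> complex) \<Rightarrow> ('b::complex_vector \<Rightarrow> complex) \<Rightarrow> ('a, 'b) tensor \<Rightarrow> complex"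
    (infixr \<open>\<times>\<^sub>f\<close> 72) where
  "\<omega> \<times>\<^sub>f \<phi> = tensor_ext (\<lambda>a b. \<omega> a * \<phi> b)"

lemma product_functional_tensor_add:
  assumes \<omega>: "Vector_Spaces.linear scaleC (*) \<omega>" and \<phi>: "Vector_Spaces.linear scaleC (*) \<phi>"
  shows product_functional_tensor: "(\<omega> \<times>\<^sub>f \<phi>) (a \<otimes>\<^sub>F b) = \<omega> a * \<phi> b"
    and product_functional_add: "(\<omega> \<times>\<^sub>f \<phi>) (x + y) = (\<omega> \<times>\<^sub>f \<phi>) x + (\<omega> \<times>\<^sub>f \<phi>) y"
proof -
  have "\<omega> (a + a') = \<omega> a + \<omega> a'" "\<omega> (c *\<^sub>C a) = c * \<omega> a" for a a' c
    using \<omega> by (simp_all add: Vector_Spaces.linear_iff)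
  moreover have "\<phi> (b + b') = \<phi> b + \<phi> b'" "\<phi> (c *\<^sub>C b) = c * \<phi> b" for b b' c
    using \<phi> by (simp_all add: Vector_Spaces.linear_iff)
  ultimately have bal: "balanced (\<lambda>a b. \<omega> a * \<phi> b)"
    by (simp add: balanced_def distrib_left distrib_right mult.assoc mult.left_commute)
  show "(\<omega> \<times>\<^sub>f \<phi>) (a \<otimes>\<^sub>F b) = \<omega> a * \<phi> b"
    unfolding product_functional_def by (rule tensor_ext_tensor[OF bal])
  show "(\<omega> \<times>\<^sub>f \<phi>) (x + y) = (\<omega> \<times>\<^sub>f \<phi>) x + (\<omega> \<times>\<^sub>f \<phi>) y"
    unfolding product_functional_def by (rule tensor_ext_add[OF bal])
qed

end

theory Submission
  imports Defs
begin

text \<open>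
  Let \<open>\<omega>\<close> be even. For homogeneous factors, \<open>(\<omega> \<times>\<^sub>f \<phi>) ((a \<otimes>\<^sub>F b)\<^sup>* (A \<otimes>\<^sub>F B))\<close> equals
  \<open>\<omega> (a\<^sup>* A) * \<phi> (b\<^sup>* B)\<close> up to the sign \<open>\<epsilon>(a, b) \<epsilon>(b, A)\<close>. This sign is 1 if \<open>a\<close> and \<open>A\<close> have the same
  grade, and otherwise \<open>a\<^sup>* A\<close> is odd and both sides vanish (\<open>inner_homogeneous\<close>). Hence the form
  \<open>(x, y) \<mapsto> (\<omega> \<times>\<^sub>f \<phi>) (x\<^sup>* y)\<close> is the ordinary tensor product of the positive forms \<open>\<omega> (a\<^sup>* A)\<close> and
  \<open>\<phi> (b\<^sup>* B)\<close>, and it is positive by Schur's theorem that the entrywise product of positive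
  semidefinite matrices is positive semidefinite (\<open>schur_product\<close>). The first estimate is the
  Cauchy-Schwarz inequality for the unit and \<open>x\<close>.

  In the second estimate, the set of all \<open>y\<close> for which a constant exists is closed under addition, so
  that \<open>y = c \<otimes>\<^sub>F d\<close> may be taken with homogeneous \<open>c\<close> and \<open>d\<close>. The reordering signs cancel as before,
  and left multiplication by \<open>y\<close> replaces the forms of \<open>\<omega>\<close> and \<open>\<phi>\<close> by forms that are bounded by
  multiples of them. Schur's theorem, applied to the differences, bounds the product of the new
  forms by a multiple of the product of the old ones (\<open>schur_product_mono\<close>).

  If \<open>\<phi>\<close> is even instead, the graded flip \<open>a \<otimes>\<^sub>F b \<mapsto> \<epsilon>(a, b) (b \<otimes>\<^sub>F a)\<close> is a *-homomorphism that
  transports \<open>\<phi> \<times>\<^sub>f \<omega>\<close> to \<open>\<omega> \<times>\<^sub>f \<phi>\<close>, because \<open>\<phi>\<close> vanishes on all \<open>b\<close> for which a sign can occur.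
\<close>

section \<open>Positive sesquilinear forms\<close>

text \<open>Forms are antilinear in the first and linear in the second argument.\<close>

locale sesquilinear_form =
  fixes f :: "'v::complex_vector \<Rightarrow> 'v \<Rightarrow> complex"
  assumes add_left: "f (u + v) w = f u w + f v w"
    and add_right: "f u (v + w) = f u v + f u w"
    and scale_left: "f (c *\<^sub>C u) v = cnj c * f u v"
    and scale_right: "f u (c *\<^sub>C v) = c * f u v"
begin

lemma zero_left: "f 0 v = 0"
  using scale_left[of 0 0 v] by simp

lemma zero_right: "f u 0 = 0"
  using scale_right[of u 0 0] by simp

lemma sum_list_left: "f (\<Sum>p\<leftarrow>xs. h p) v = (\<Sum>p\<leftarrow>xs. f (h p) v)"
  by (induction xs) (simp_all add: zero_left add_left)

lemma sum_list_right: "f u (\<Sum>p\<leftarrow>xs. h p) = (\<Sum>p\<leftarrow>xs. f u (h p))"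
  by (induction xs) (simp_all add: zero_right add_right)

lemma sum_list_both:
  "f (\<Sum>p\<leftarrow>xs. h p) (\<Sum>p\<leftarrow>xs. h p) = (\<Sum>p\<leftarrow>xs. \<Sum>q\<leftarrow>xs. f (h p) (h q))"
  unfolding sum_list_left by (simp only: sum_list_right)

end

locale positive_form = sesquilinear_form +
  assumes nonneg: "0 \<le> f u u"
begin

lemma Im_diag: "Im (f u u) = 0"
  using nonneg[of u] by (simp add: less_eq_complex_def)

lemma Re_diag: "0 \<le> Re (f u u)"
  using nonneg[of u] by (simp add: less_eq_complex_def)

lemma diag_of_real: "f u u = complex_of_real (Re (f u u))"
  by (simp add: complex_eq_iff Im_diag)

lemma hermitian: "f v u = cnj (f u v)"
proof -
  have "f (u + v) (u + v) = f u u + f u v + f v u + f v v"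
    by (simp add: add_left add_right)
  then have 1: "Im (f u v + f v u) = 0"
    using Im_diag[of "u + v"] Im_diag[of u] Im_diag[of v] by simp
  have "f (u + \<i> *\<^sub>C v) (u + \<i> *\<^sub>C v) = f u u + \<i> * f u v - \<i> * f v u + f v v"
    by (simp add: add_left add_right scale_left scale_right algebra_simps)
  then have "Im (\<i> * f u v - \<i> * f v u) = 0"
    using Im_diag[of "u + \<i> *\<^sub>C v"] Im_diag[of u] Im_diag[of v] by simp
  with 1 show ?thesis by (simp add: complex_eq_iff)
qed

lemma diag_expand:
  "Re (f (u + c *\<^sub>C v) (u + c *\<^sub>C v)) = Re (f u u) + 2 * Re (c * f u v) + (cmod c)\<^sup>2 * Re (f v v)"
proof -
  have "f (u + c *\<^sub>C v) (u + c *\<^sub>C v) = f u u + c * f u v + cnj (c * f u v) + (c * cnj c) * f v v"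
    using hermitian[of v u] by (simp add: add_left add_right scale_left scale_right algebra_simps)
  also have "\<dots> = f u u + c * f u v + cnj (c * f u v) + complex_of_real ((cmod c)\<^sup>2) * f v v"
    by (simp only: complex_norm_square)
  finally show ?thesis by (simp del: of_real_power)
qed

lemma cauchy_schwarz: "(cmod (f u v))\<^sup>2 \<le> Re (f u u) * Re (f v v)"
proof -
  define N where "N = (cmod (f u v))\<^sup>2"
  \<comment> \<open>The phase of the coefficient makes the cross term real; \<open>t\<close> is chosen below.\<close>
  have *: "0 \<le> Re (f u u) - 2 * t * N + t\<^sup>2 * N * Re (f v v)" for t
  proof -
    let ?c = "- (complex_of_real t * cnj (f u v))"
    have "0 \<le> Re (f u u) + 2 * Re (?c * f u v) + (cmod ?c)\<^sup>2 * Re (f v v)"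
      using Re_diag[of "u + ?c *\<^sub>C v"] unfolding diag_expand .
    moreover have "Re (?c * f u v) = - t * N"
      unfolding N_def cmod_power2 by (simp add: power2_eq_square algebra_simps)
    moreover have "(cmod ?c)\<^sup>2 = t\<^sup>2 * N"
      by (simp add: N_def norm_mult power_mult_distrib)
    ultimately show ?thesis by simp
  qed
  show ?thesis
  proof (cases "Re (f v v) = 0")
    case True
    have "N = 0"
    proof (rule ccontr)
      assume "N \<noteq> 0"
      then have "N > 0" by (simp add: N_def)
      with *[of "(Re (f u u) + 1) / (2 * N)"] True show False by (simp add: field_simps)
    qed
    with True show ?thesis by (simp add: N_def)
  next
    case False
    with Re_diag[of v] have "Re (f v v) > 0" by simp
    with *[of "1 / Re (f v v)"] have "N \<le> Re (f u u) * Re (f v v)"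
      by (simp add: field_simps power2_eq_square)
    then show ?thesis by (simp add: N_def)
  qed
qed

lemma diag_add_le: "f (u + v) (u + v) \<le> 2 * f u u + 2 * f v v"
proof -
  have "f (u + v) (u + v) + f (u + (-1) *\<^sub>C v) (u + (-1) *\<^sub>C v) = 2 * f u u + 2 * f v v"
    by (simp only: add_left add_right scale_left scale_right) simp
  moreover have "0 \<le> f (u + (-1) *\<^sub>C v) (u + (-1) *\<^sub>C v)"
    by (rule nonneg)
  ultimately show ?thesis by (metis le_add_same_cancel1)
qed

lemma kernel_if_null: "f w w = 0 \<Longrightarrow> f w v = 0"
  using cauchy_schwarz[of w v] by simp

text \<open>
  For \<open>f w w \<noteq> 0\<close>, subtracting the rank-one form below amounts to projecting both arguments onto the
  orthogonal complement of \<open>w\<close>. For \<open>f w w = 0\<close> the division by zero leaves \<open>f\<close> unchanged, and \<open>w\<close>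
  lies in the kernel already, so that the next three lemmas hold in both cases.
\<close>

lemma positive_form_deflate: "positive_form (\<lambda>u v. f u v - f u w * f w v / f w w)"
proof
  fix u
  have "f u w * f w u = complex_of_real ((cmod (f u w))\<^sup>2)"
    using hermitian[of w u] by (simp add: complex_norm_square del: of_real_power)
  then have "f u u - f u w * f w u / f w w
      = complex_of_real (Re (f u u) - (cmod (f u w))\<^sup>2 / Re (f w w))"
    by (subst (1 2) diag_of_real) simp
  moreover have "(cmod (f u w))\<^sup>2 / Re (f w w) \<le> Re (f u u)"
    using cauchy_schwarz[of u w] Re_diag[of u] Re_diag[of w]
    by (cases "Re (f w w) = 0") (simp_all add: divide_le_eq)
  ultimately show "0 \<le> f u u - f u w * f w u / f w w"
    by (simp add: less_eq_complex_def)
qed (simp_all add: add_left add_right scale_left scale_right add_divide_distrib algebra_simps)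

lemma deflate_left: "f w v - f w w * f w v / f w w = 0"
  using kernel_if_null[of w v] by (cases "f w w = 0") simp_all

lemma deflate_right: "f v w - f v w * f w w / f w w = 0"
  using hermitian[of v w] kernel_if_null[of w v] by (cases "f w w = 0") simp_all

end

text \<open>
  Schur's product theorem for the Gram matrices of the vectors \<open>fst p\<close> and \<open>snd p\<close>. The form \<open>f\<close> is
  split into a rank-one form and a positive form with the first of the vectors in its kernel. The
  rank-one part contributes a nonnegative multiple of a single value \<open>g z z\<close>, and the other part
  only involves the remaining vectors.
\<close>

theorem schur_product:
  fixes f :: "'v::complex_vector \<Rightarrow> 'v \<Rightarrow> complex" and g :: "'w::complex_vector \<Rightarrow> 'w \<Rightarrow> complex"
  assumes f: "positive_form f" and g: "positive_form g"
  shows "0 \<le> (\<Sum>p\<leftarrow>xs. \<Sum>q\<leftarrow>xs. f (fst p) (fst q) * g (snd p) (snd q))"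
  using f
proof (induction xs arbitrary: f)
  case Nil
  then show ?case by simp
next
  case (Cons r xs)
  interpret f: positive_form f by (rule Cons.prems)
  interpret g: positive_form g by (rule g)
  let ?w = "fst r"
  define f' where "f' u v = f u v - f u ?w * f ?w v / f ?w ?w" for u v
  have f': "positive_form f'"
    unfolding f'_def by (rule f.positive_form_deflate)
  have kill: "f' ?w v = 0" "f' v ?w = 0" for v
    unfolding f'_def by (rule f.deflate_left, rule f.deflate_right)
  \<comment> \<open>the vector at which \<open>g\<close> is evaluated by the rank-one part of \<open>f\<close>\<close>
  define z where "z = (\<Sum>q\<leftarrow>r # xs. f ?w (fst q) *\<^sub>C snd q)"
  have split: "f u v = f' u v + (1 / f ?w ?w) * (cnj (f ?w u) * f ?w v)" for u v
    using f.hermitian[of u ?w] by (simp add: f'_def)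
  have "(\<Sum>p\<leftarrow>r # xs. \<Sum>q\<leftarrow>r # xs. f (fst p) (fst q) * g (snd p) (snd q))
      = (\<Sum>p\<leftarrow>r # xs. \<Sum>q\<leftarrow>r # xs. f' (fst p) (fst q) * g (snd p) (snd q))
        + (1 / f ?w ?w) * (\<Sum>p\<leftarrow>r # xs. \<Sum>q\<leftarrow>r # xs.
            g (f ?w (fst p) *\<^sub>C snd p) (f ?w (fst q) *\<^sub>C snd q))"
    unfolding sum_list_addf[symmetric] sum_list_const_mult[symmetric]
    by (intro arg_cong[where f = sum_list] map_cong refl, subst split)
      (simp add: g.scale_left g.scale_right algebra_simps)
  also have "(\<Sum>p\<leftarrow>r # xs. \<Sum>q\<leftarrow>r # xs. f' (fst p) (fst q) * g (snd p) (snd q))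
      = (\<Sum>p\<leftarrow>xs. \<Sum>q\<leftarrow>xs. f' (fst p) (fst q) * g (snd p) (snd q))"
    by (simp add: kill)
  also have "(\<Sum>p\<leftarrow>r # xs. \<Sum>q\<leftarrow>r # xs. g (f ?w (fst p) *\<^sub>C snd p) (f ?w (fst q) *\<^sub>C snd q)) = g z z"
    unfolding z_def by (rule g.sum_list_both[symmetric])
  also have "0 \<le> (\<Sum>p\<leftarrow>xs. \<Sum>q\<leftarrow>xs. f' (fst p) (fst q) * g (snd p) (snd q))
      + (1 / f ?w ?w) * g z z"
  proof (rule add_nonneg_nonneg)
    show "0 \<le> (\<Sum>p\<leftarrow>xs. \<Sum>q\<leftarrow>xs. f' (fst p) (fst q) * g (snd p) (snd q))"
      by (rule Cons.IH[OF f'])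
    have "(1 / f ?w ?w) * g z z = complex_of_real (Re (g z z) / Re (f ?w ?w))"
      by (subst f.diag_of_real, subst g.diag_of_real) simp
    then show "0 \<le> (1 / f ?w ?w) * g z z"
      using f.Re_diag[of ?w] g.Re_diag[of z] by (simp add: less_eq_complex_def)
  qed
  finally show ?case .
qed

lemma positive_form_diff:
  assumes f: "positive_form f" and f1: "positive_form f1" and le: "\<And>u. f1 u u \<le> complex_of_real C * f u u"
  shows "positive_form (\<lambda>u v. complex_of_real C * f u v - f1 u v)"
proof -
  interpret f: positive_form f by (rule f)
  interpret f1: positive_form f1 by (rule f1)
  show ?thesis
    using le by unfold_locales
      (simp_all add: f.add_left f.add_right f.scale_left f.scale_right
        f1.add_left f1.add_right f1.scale_left f1.scale_right algebra_simps)
qed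

lemma schur_product_mono:
  fixes f f1 :: "'v::complex_vector \<Rightarrow> 'v \<Rightarrow> complex" and g g1 :: "'w::complex_vector \<Rightarrow> 'w \<Rightarrow> complex"
  assumes f: "positive_form f" and f1: "positive_form f1" and g: "positive_form g" and g1: "positive_form g1"
    and f_le: "\<And>u. f1 u u \<le> complex_of_real C * f u u" and g_le: "\<And>u. g1 u u \<le> complex_of_real D * g u u"
    and "0 \<le> C"
  shows "(\<Sum>p\<leftarrow>xs. \<Sum>q\<leftarrow>xs. f1 (fst p) (fst q) * g1 (snd p) (snd q))
    \<le> complex_of_real (C * D) * (\<Sum>p\<leftarrow>xs. \<Sum>q\<leftarrow>xs. f (fst p) (fst q) * g (snd p) (snd q))"
proof -
  \<comment> \<open>\<open>C D f g - f1 g1 = (C f - f1) g1 + C f (D g - g1)\<close>\<close>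
  let ?R = "\<Sum>p\<leftarrow>xs. \<Sum>q\<leftarrow>xs. (complex_of_real C * f (fst p) (fst q) - f1 (fst p) (fst q)) * g1 (snd p) (snd q)"
  let ?S = "\<Sum>p\<leftarrow>xs. \<Sum>q\<leftarrow>xs. f (fst p) (fst q) * (complex_of_real D * g (snd p) (snd q) - g1 (snd p) (snd q))"
  have R: "0 \<le> ?R"
    by (rule schur_product[OF positive_form_diff[OF f f1 f_le] g1])
  have S: "0 \<le> ?S"
    by (rule schur_product[OF f positive_form_diff[OF g g1 g_le]])
  have "complex_of_real (C * D) * (\<Sum>p\<leftarrow>xs. \<Sum>q\<leftarrow>xs. f (fst p) (fst q) * g (snd p) (snd q))
      = (\<Sum>p\<leftarrow>xs. \<Sum>q\<leftarrow>xs. f1 (fst p) (fst q) * g1 (snd p) (snd q)) + (?R + complex_of_real C * ?S)"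
    unfolding sum_list_addf[symmetric] sum_list_const_mult[symmetric]
    by (intro arg_cong[where f = sum_list] map_cong refl) (simp add: algebra_simps)
  moreover have "0 \<le> ?R + complex_of_real C * ?S"
    using R S \<open>0 \<le> C\<close> by (simp add: less_eq_complex_def)
  ultimately show ?thesis by (simp only: le_add_same_cancel1)
qed


section \<open>Homogeneous elements\<close>

lemma star_one: "star (1 :: 'a::complex_star_algebra) = 1"
  using star_mult[of "star (1 :: 'a)" 1] star_star[of "1 :: 'a"] by simp

lemma z2_grading_one:
  assumes "z2_grading \<theta>"
  shows "\<theta> 1 = 1"
proof -
  have "\<theta> 1 = \<theta> 1 * \<theta> (\<theta> 1)" by (simp add: z2_gradingD(5)[OF assms])
  also have "\<dots> = \<theta> (\<theta> 1)" by (simp flip: z2_gradingD(3)[OF assms])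
  finally show ?thesis by (simp add: z2_gradingD(5)[OF assms])
qed

lemma has_grade_one: "z2_grading \<theta> \<Longrightarrow> has_grade \<theta> 1 1"
  by (simp add: has_grade_def z2_grading_one)

lemma has_grade_mult:
  "z2_grading \<theta> \<Longrightarrow> has_grade \<theta> s x \<Longrightarrow> has_grade \<theta> t y \<Longrightarrow> has_grade \<theta> (s * t) (x * y)"
  by (simp add: has_grade_def z2_gradingD scaleC_mult_left scaleC_mult_right scaleC_scaleC mult.commute)

lemma has_grade_star: "z2_grading \<theta> \<Longrightarrow> has_grade \<theta> s x \<Longrightarrow> has_grade \<theta> s (star x)"
  by (simp add: has_grade_def z2_gradingD star_scaleC)

lemma fermi_sign_commute: "fermi_sign s t = fermi_sign t s"
  by (simp add: fermi_sign_def)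

lemma fermi_sign_one: "fermi_sign 1 t = 1" "fermi_sign t 1 = 1"
  by (simp_all add: fermi_sign_def)

lemma fermi_sign_square: "fermi_sign s t * fermi_sign s t = 1"
  by (simp add: fermi_sign_def)

lemma cnj_fermi_sign: "cnj (fermi_sign s t) = fermi_sign s t"
  by (simp add: fermi_sign_def)

lemma even_functional_odd_element:
  assumes "even_functional \<theta> f" "Vector_Spaces.linear scaleC (*) f" "has_grade \<theta> (-1) a"
  shows "f a = 0"
proof -
  have "f a = f (\<theta> a)"
    using assms(1) by (metis even_functional_def comp_apply)
  also have "\<dots> = - f a"
    using assms(2,3) by (simp add: has_grade_def Vector_Spaces.linear_iff del: cvec.scale_minus_left)
  finally show ?thesis by simp
qed

text \<open>
  For \<open>c = 1\<close> this is the GNS form of \<open>f\<close>, and for other \<open>c\<close> its pullback along left multiplication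
  by \<open>c\<close>.
\<close>

lemma positive_form_of_functional:
  fixes f :: "'a::complex_star_algebra \<Rightarrow> complex"
  assumes "positive_functional (*) star f"
  shows "positive_form (\<lambda>a b. f (star (c * a) * (c * b)))"
proof -
  have "f (x + y) = f x + f y" "f (k *\<^sub>C x) = k * f x" for x y k
    using assms by (simp_all add: positive_functional_def Vector_Spaces.linear_iff)
  moreover have "0 \<le> f (star x * x)" for x
    using assms by (simp add: positive_functional_def)
  ultimately show ?thesis
    by unfold_locales (simp_all add: star_add star_scaleC distrib_left distrib_right
        scaleC_mult_left scaleC_mult_right)
qed

locale graded_pair =
  fixes \<alpha> :: "'a::complex_star_algebra \<Rightarrow> 'a" and \<beta> :: "'b::complex_star_algebra \<Rightarrow> 'b"
  assumes \<alpha>: "z2_grading \<alpha>" and \<beta>: "z2_grading \<beta>"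
begin

text \<open>Both factors of \<open>a \<otimes>\<^sub>F b\<close> are homogeneous, with grades \<open>s\<close> and \<open>t\<close>.\<close>

definition homogeneous :: "int \<Rightarrow> int \<Rightarrow> 'a \<Rightarrow> 'b \<Rightarrow> bool" where
  "homogeneous s t a b \<longleftrightarrow> s \<in> {1, -1} \<and> t \<in> {1, -1} \<and> has_grade \<alpha> s a \<and> has_grade \<beta> t b"

lemma homogeneous_induct [case_names homogeneous add]:
  assumes hom: "\<And>s t a b. homogeneous s t a b \<Longrightarrow> P (a \<otimes>\<^sub>F b)"
    and add: "\<And>x y. P x \<Longrightarrow> P y \<Longrightarrow> P (x + y)"
  shows "P x"
proof (induction x rule: tensor_induct)
  case (tensor a b)
  have P: "P (grade_part \<alpha> s a \<otimes>\<^sub>F grade_part \<beta> t b)" if "s \<in> {1, -1}" "t \<in> {1, -1}" for s t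
    using that by (intro hom[of s t]) (simp add: homogeneous_def grade_part_has_grade[OF \<alpha>] grade_part_has_grade[OF \<beta>])
  have "P ((grade_part \<alpha> 1 a + grade_part \<alpha> (-1) a) \<otimes>\<^sub>F (grade_part \<beta> 1 b + grade_part \<beta> (-1) b))"
    unfolding tensor_add_left tensor_add_right by (intro add P) simp_all
  then show ?case by (simp only: grade_part_sum)
qed (rule add)

text \<open>A list allows for repeated summands.\<close>

lemma homogeneous_decomposition:
  obtains xs where "\<forall>p\<in>set xs. \<exists>s t. homogeneous s t (fst p) (snd p)"
    and "x = (\<Sum>p\<leftarrow>xs. fst p \<otimes>\<^sub>F snd p)"
proof -
  have "\<exists>xs. (\<forall>p\<in>set xs. \<exists>s t. homogeneous s t (fst p) (snd p)) \<and> x = (\<Sum>p\<leftarrow>xs. fst p \<otimes>\<^sub>F snd p)"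
  proof (induction x rule: homogeneous_induct)
    case (homogeneous s t a b)
    then show ?case by (intro exI[of _ "[(a, b)]"]) auto
  next
    case (add x y)
    then obtain xs ys where "\<forall>p\<in>set xs. \<exists>s t. homogeneous s t (fst p) (snd p)" "x = (\<Sum>p\<leftarrow>xs. fst p \<otimes>\<^sub>F snd p)"
      "\<forall>p\<in>set ys. \<exists>s t. homogeneous s t (fst p) (snd p)" "y = (\<Sum>p\<leftarrow>ys. fst p \<otimes>\<^sub>F snd p)"
      by blast
    then show ?case by (intro exI[of _ "xs @ ys"]) auto
  qed
  then show ?thesis using that by blast
qed


section \<open>The Fermi tensor product as a *-algebra\<close>

abbreviation mul (infixl "\<cdot>" 70) where "x \<cdot> y \<equiv> fermi_mult \<alpha> \<beta> x y"
abbreviation adj where "adj \<equiv> fermi_star \<alpha> \<beta>"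

lemmas mul_add = fermi_mult_add_left[OF \<alpha> \<beta>] fermi_mult_add_right[OF \<alpha> \<beta>]
lemmas adj_add = fermi_star_add[OF \<alpha> \<beta>]

lemma mul_homogeneous:
  "homogeneous s t a b \<Longrightarrow> homogeneous S T A B \<Longrightarrow>
    (a \<otimes>\<^sub>F b) \<cdot> (A \<otimes>\<^sub>F B) = fermi_sign t S *\<^sub>C ((a * A) \<otimes>\<^sub>F (b * B))"
  unfolding homogeneous_def by (rule fermi_mult_homogeneous[OF \<alpha> \<beta>]) auto

lemma adj_homogeneous:
  "homogeneous s t a b \<Longrightarrow> adj (a \<otimes>\<^sub>F b) = fermi_sign s t *\<^sub>C (star a \<otimes>\<^sub>F star b)"
  unfolding homogeneous_def by (rule fermi_star_homogeneous[OF \<alpha> \<beta>]) auto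

lemma homogeneous_mult:
  "homogeneous s t a b \<Longrightarrow> homogeneous S T A B \<Longrightarrow> homogeneous (s * S) (t * T) (a * A) (b * B)"
  unfolding homogeneous_def by (intro conjI has_grade_mult[OF \<alpha>] has_grade_mult[OF \<beta>]) auto

lemma homogeneous_star: "homogeneous s t a b \<Longrightarrow> homogeneous s t (star a) (star b)"
  by (simp add: homogeneous_def has_grade_star[OF \<alpha>] has_grade_star[OF \<beta>])

lemma homogeneous_scale: "homogeneous s t a b \<Longrightarrow> homogeneous s t (c *\<^sub>C a) b"
  by (simp add: homogeneous_def has_grade_def z2_gradingD[OF \<alpha>] scaleC_scaleC mult.commute)

lemma homogeneous_one: "homogeneous 1 1 1 1"
  by (simp add: homogeneous_def has_grade_one \<alpha> \<beta>)

lemma mul_scale_left: "(c *\<^sub>C x) \<cdot> y = c *\<^sub>C (x \<cdot> y)"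
proof (induction x rule: homogeneous_induct)
  case (homogeneous s t a b)
  then show ?case
  proof (induction y rule: homogeneous_induct)
    case h: (homogeneous S T A B)
    then show ?case
      using mul_homogeneous[OF homogeneous_scale[OF h(2), of c] h(1)] mul_homogeneous[OF h(2,1)]
      by (simp add: scaleC_mult_left tensor_scale_left scaleC_scaleC mult.commute)
  qed (simp add: mul_add scaleC_add_right)
qed (simp add: mul_add scaleC_add_right)

lemma mul_scale_right: "x \<cdot> (c *\<^sub>C y) = c *\<^sub>C (x \<cdot> y)"
proof (induction x rule: homogeneous_induct)
  case (homogeneous s t a b)
  then show ?case
  proof (induction y rule: homogeneous_induct)
    case h: (homogeneous S T A B)
    then show ?case
      using mul_homogeneous[OF h(2) homogeneous_scale[OF h(1), of c]] mul_homogeneous[OF h(2,1)]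
      by (simp add: scaleC_mult_right tensor_scale_left scaleC_scaleC mult.commute)
  qed (simp add: mul_add scaleC_add_right)
qed (simp add: mul_add scaleC_add_right)

lemma adj_scale: "adj (c *\<^sub>C x) = cnj c *\<^sub>C adj x"
proof (induction x rule: homogeneous_induct)
  case (homogeneous s t a b)
  then show ?case
    using adj_homogeneous[OF homogeneous_scale[OF homogeneous, of c]] adj_homogeneous[OF homogeneous]
    by (simp add: star_scaleC tensor_scale_left scaleC_scaleC mult.commute)
qed (simp add: adj_add scaleC_add_right)

lemma adj_mul: "adj (x \<cdot> y) = adj y \<cdot> adj x"
proof (induction x rule: homogeneous_induct)
  case (homogeneous s t a b)
  then show ?case
  proof (induction y rule: homogeneous_induct)
    case h: (homogeneous S T A B)
    have signs: "s \<in> {1, -1}" "t \<in> {1, -1}" "S \<in> {1, -1}" "T \<in> {1, -1}"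
      using h by (simp_all add: homogeneous_def)
    show ?case
      using signs
      by (simp add: mul_homogeneous[OF h(2,1)] adj_scale adj_homogeneous[OF homogeneous_mult[OF h(2,1)]]
          adj_homogeneous[OF h(1)] adj_homogeneous[OF h(2)] mul_scale_left mul_scale_right
          mul_homogeneous[OF homogeneous_star[OF h(1)] homogeneous_star[OF h(2)]]
          star_mult scaleC_scaleC)
        (auto simp: fermi_sign_def)
  qed (simp add: mul_add adj_add)
qed (simp add: mul_add adj_add)

lemma adj_one: "adj (1 \<otimes>\<^sub>F 1) = 1 \<otimes>\<^sub>F 1"
  by (simp add: adj_homogeneous[OF homogeneous_one] fermi_sign_one star_one)

lemma mul_one_left: "(1 \<otimes>\<^sub>F 1) \<cdot> x = x"
proof (induction x rule: homogeneous_induct)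
  case (homogeneous s t a b)
  then show ?case by (simp add: mul_homogeneous[OF homogeneous_one] fermi_sign_one)
qed (simp add: mul_add)

end


section \<open>The graded flip\<close>

text \<open>
  The extension of \<open>a \<otimes>\<^sub>F b \<mapsto> \<epsilon>(a, b) (b \<otimes>\<^sub>F a)\<close> from homogeneous factors, written for arbitrary
  factors by means of their homogeneous components. The flip without the sign is not multiplicative in general.
\<close>

definition fermi_flip :: "('a::complex_star_algebra \<Rightarrow> 'a) \<Rightarrow> ('b::complex_star_algebra \<Rightarrow> 'b) \<Rightarrow>
    ('a, 'b) tensor \<Rightarrow> ('b, 'a) tensor" where
  "fermi_flip \<alpha> \<beta> = tensor_ext (\<lambda>a b. \<Sum>s\<in>{1, -1}. \<Sum>t\<in>{1, -1}.
     fermi_sign s t *\<^sub>C (grade_part \<beta> t b \<otimes>\<^sub>F grade_part \<alpha> s a))"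

context graded_pair
begin

interpretation flipped: graded_pair \<beta> \<alpha>
  by unfold_locales (rule \<alpha> \<beta>)+

lemma homogeneous_swap: "homogeneous s t a b \<Longrightarrow> flipped.homogeneous t s b a"
  by (simp add: homogeneous_def flipped.homogeneous_def)

lemma balanced_flip:
  "balanced (\<lambda>a b. \<Sum>s\<in>{1, -1}. \<Sum>t\<in>{1, -1}.
     fermi_sign s t *\<^sub>C (grade_part \<beta> t b \<otimes>\<^sub>F grade_part \<alpha> s a))"
proof -
  have "balanced (\<lambda>a b. fermi_sign s t *\<^sub>C (grade_part \<beta> t b \<otimes>\<^sub>F grade_part \<alpha> s a))" for s t
    by (simp add: balanced_def grade_part_add[OF \<alpha>] grade_part_scale[OF \<alpha>] grade_part_add[OF \<beta>]
        grade_part_scale[OF \<beta>] tensor_add_left tensor_add_right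
        tensor_scale_left tensor_scale_right scaleC_add_right)
  then show ?thesis by (intro balanced_sum)
qed

lemma flip_add: "fermi_flip \<alpha> \<beta> (x + y) = fermi_flip \<alpha> \<beta> x + fermi_flip \<alpha> \<beta> y"
  unfolding fermi_flip_def by (rule tensor_ext_add[OF balanced_flip])

lemma flip_homogeneous:
  assumes "homogeneous s t a b"
  shows "fermi_flip \<alpha> \<beta> (a \<otimes>\<^sub>F b) = fermi_sign s t *\<^sub>C (b \<otimes>\<^sub>F a)"
proof -
  have st: "s \<in> {1, -1}" "t \<in> {1, -1}" and "has_grade \<alpha> s a" "has_grade \<beta> t b"
    using assms by (simp_all add: homogeneous_def)
  then have "grade_part \<alpha> s' a = (if s' = s then a else 0)" "grade_part \<beta> s' b = (if s' = t then b else 0)"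
    if "s' \<in> {1, -1}" for s'
    using that by (intro grade_part_homogeneous; simp)+
  then show ?thesis
    unfolding fermi_flip_def tensor_ext_tensor[OF balanced_flip] using st by (auto simp: tensor_zero)
qed

lemma flip_scale: "fermi_flip \<alpha> \<beta> (c *\<^sub>C x) = c *\<^sub>C fermi_flip \<alpha> \<beta> x"
proof (induction x rule: homogeneous_induct)
  case (homogeneous s t a b)
  then show ?case
    using flip_homogeneous[OF homogeneous_scale[OF homogeneous, of c]] flip_homogeneous[OF homogeneous]
    by (simp add: tensor_scale_left tensor_scale_right scaleC_scaleC mult.commute)
qed (simp add: flip_add scaleC_add_right)

lemma flip_mul: "fermi_flip \<alpha> \<beta> (x \<cdot> y) = fermi_mult \<beta> \<alpha> (fermi_flip \<alpha> \<beta> x) (fermi_flip \<alpha> \<beta> y)"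
proof (induction x rule: homogeneous_induct)
  case (homogeneous s t a b)
  then show ?case
  proof (induction y rule: homogeneous_induct)
    case h: (homogeneous S T A B)
    have signs: "s \<in> {1, -1}" "t \<in> {1, -1}" "S \<in> {1, -1}" "T \<in> {1, -1}"
      using h by (simp_all add: homogeneous_def)
    show ?case
      using signs
      by (simp add: mul_homogeneous[OF h(2,1)] flip_scale flip_homogeneous[OF homogeneous_mult[OF h(2,1)]]
          flip_homogeneous[OF h(1)] flip_homogeneous[OF h(2)] flipped.mul_scale_left flipped.mul_scale_right
          flipped.mul_homogeneous[OF homogeneous_swap[OF h(2)] homogeneous_swap[OF h(1)]]
          scaleC_scaleC)
        (auto simp: fermi_sign_def)
  qed (simp add: mul_add flipped.mul_add flip_add)
qed (simp add: mul_add flipped.mul_add flip_add)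

lemma flip_adj: "fermi_flip \<alpha> \<beta> (adj x) = fermi_star \<beta> \<alpha> (fermi_flip \<alpha> \<beta> x)"
proof (induction x rule: homogeneous_induct)
  case h: (homogeneous s t a b)
  show ?case
    by (simp add: adj_homogeneous[OF h] flip_scale flip_homogeneous[OF homogeneous_star[OF h]]
        flip_homogeneous[OF h] flipped.adj_scale flipped.adj_homogeneous[OF homogeneous_swap[OF h]]
        scaleC_scaleC cnj_fermi_sign fermi_sign_commute)
qed (simp add: adj_add flipped.adj_add flip_add)

text \<open>The sign in the flip is invisible here, since it only occurs where \<open>\<phi> b = 0\<close>.\<close>

lemma product_functional_flip:
  assumes \<omega>: "Vector_Spaces.linear scaleC (*) \<omega>" and \<phi>: "Vector_Spaces.linear scaleC (*) \<phi>"
    and even: "even_functional \<beta> \<phi>"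
  shows "(\<omega> \<times>\<^sub>f \<phi>) x = (\<phi> \<times>\<^sub>f \<omega>) (fermi_flip \<alpha> \<beta> x)"
proof (induction x rule: homogeneous_induct)
  case h: (homogeneous s t a b)
  show ?case
  proof (cases "t = -1")
    case True
    then have "\<phi> b = 0"
      using h by (intro even_functional_odd_element[OF even \<phi>]) (simp add: homogeneous_def)
    then show ?thesis
      by (simp add: product_functional_tensor[OF \<omega> \<phi>] product_functional_tensor[OF \<phi> \<omega>]
          flip_homogeneous[OF h] flip: tensor_scale_right)
  next
    case False
    then show ?thesis
      by (simp add: product_functional_tensor[OF \<omega> \<phi>] product_functional_tensor[OF \<phi> \<omega>]
          flip_homogeneous[OF h] fermi_sign_def mult.commute)
  qed
qed (simp add: flip_add product_functional_add[OF \<omega> \<phi>] product_functional_add[OF \<phi> \<omega>])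

end


section \<open>Product functionals with an even first factor\<close>

lemma product_functional_scale:
  assumes \<omega>: "Vector_Spaces.linear scaleC (*) \<omega>" and \<phi>: "Vector_Spaces.linear scaleC (*) \<phi>"
  shows "(\<omega> \<times>\<^sub>f \<phi>) (c *\<^sub>C x) = c * (\<omega> \<times>\<^sub>f \<phi>) x"
proof (induction x rule: tensor_induct)
  case (tensor a b)
  have "\<omega> (c *\<^sub>C a) = c * \<omega> a" using \<omega> by (simp add: Vector_Spaces.linear_iff)
  then show ?case
    by (simp add: product_functional_tensor[OF \<omega> \<phi>] flip: tensor_scale_left)
qed (simp add: scaleC_add_right product_functional_add[OF \<omega> \<phi>] distrib_left)

lemma product_functional_linear:
  assumes "Vector_Spaces.linear scaleC (*) \<omega>" and "Vector_Spaces.linear scaleC (*) \<phi>"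
  shows "Vector_Spaces.linear scaleC (*) (\<omega> \<times>\<^sub>f \<phi>)"
proof -
  have "vector_space ((*) :: complex \<Rightarrow> complex \<Rightarrow> complex)"
    by unfold_locales (simp_all add: algebra_simps)
  then show ?thesis
    using assms by (simp add: Vector_Spaces.linear_iff product_functional_scale product_functional_add
        cvec.vector_space_axioms)
qed

locale even_product = graded_pair +
  fixes \<omega> :: "'a \<Rightarrow> complex" and \<phi> :: "'b \<Rightarrow> complex"
  assumes state_\<omega>: "state \<omega>" and state_\<phi>: "state \<phi>" and even: "even_functional \<alpha> \<omega>"
begin

lemma positive_\<omega>: "positive_functional (*) star \<omega>" and positive_\<phi>: "positive_functional (*) star \<phi>"
  using state_\<omega> state_\<phi> by (simp_all add: state_def)

lemma linear_\<omega>: "Vector_Spaces.linear scaleC (*) \<omega>" and linear_\<phi>: "Vector_Spaces.linear scaleC (*) \<phi>"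
  using positive_\<omega> positive_\<phi> by (simp_all add: positive_functional_def)

text \<open>The GNS form of the product functional.\<close>

definition inner where "inner x y = (\<omega> \<times>\<^sub>f \<phi>) (adj x \<cdot> y)"

sublocale inner: sesquilinear_form inner
  by unfold_locales (simp_all add: inner_def adj_add adj_scale mul_add mul_scale_left mul_scale_right
      product_functional_add[OF linear_\<omega> linear_\<phi>] product_functional_scale[OF linear_\<omega> linear_\<phi>])

lemma inner_homogeneous:
  assumes h: "homogeneous s t a b" and H: "homogeneous S T A B"
  shows "inner (a \<otimes>\<^sub>F b) (A \<otimes>\<^sub>F B) = \<omega> (star a * A) * \<phi> (star b * B)"
proof -
  have *: "inner (a \<otimes>\<^sub>F b) (A \<otimes>\<^sub>F B) = fermi_sign s t * fermi_sign t S * (\<omega> (star a * A) * \<phi> (star b * B))"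
    by (simp add: inner_def adj_homogeneous[OF h] mul_scale_left mul_homogeneous[OF homogeneous_star[OF h] H]
        product_functional_scale[OF linear_\<omega> linear_\<phi>] product_functional_tensor[OF linear_\<omega> linear_\<phi>])
  show ?thesis
  proof (cases "s = S")
    case True
    with * show ?thesis
      using fermi_sign_square[of s t] by (simp add: fermi_sign_commute[of t])
  next
    case False
    then have "s * S = -1" "has_grade \<alpha> (s * S) (star a * A)"
      using h H by (auto simp: homogeneous_def intro!: has_grade_mult[OF \<alpha>] has_grade_star[OF \<alpha>])
    then have "\<omega> (star a * A) = 0"
      by (intro even_functional_odd_element[OF even linear_\<omega>]) simp
    with * show ?thesis by simp
  qed
qed

text \<open>
  Moving \<open>d\<close> past \<open>fst p\<close> and \<open>fst q\<close> produces one sign each. The two signs agree unless \<open>fst p\<close> and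
  \<open>fst q\<close> have different grades, when the value of the even functional \<open>\<omega>\<close> is zero.
\<close>

lemma inner_translate:
  assumes y: "homogeneous s t c d" and xs: "\<forall>p\<in>set xs. \<exists>s t. homogeneous s t (fst p) (snd p)"
  shows "inner ((c \<otimes>\<^sub>F d) \<cdot> (\<Sum>p\<leftarrow>xs. fst p \<otimes>\<^sub>F snd p)) ((c \<otimes>\<^sub>F d) \<cdot> (\<Sum>p\<leftarrow>xs. fst p \<otimes>\<^sub>F snd p))
    = (\<Sum>p\<leftarrow>xs. \<Sum>q\<leftarrow>xs. \<omega> (star (c * fst p) * (c * fst q)) * \<phi> (star (d * snd p) * (d * snd q)))"
proof -
  have zero: "(c \<otimes>\<^sub>F d) \<cdot> 0 = 0"
    using mul_scale_right[of "c \<otimes>\<^sub>F d" 0 0] by simp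
  have "(c \<otimes>\<^sub>F d) \<cdot> (\<Sum>p\<leftarrow>xs. fst p \<otimes>\<^sub>F snd p) = (\<Sum>p\<leftarrow>xs. (c \<otimes>\<^sub>F d) \<cdot> (fst p \<otimes>\<^sub>F snd p))"
    by (induction xs) (simp_all add: zero mul_add)
  moreover have "inner ((c \<otimes>\<^sub>F d) \<cdot> (fst p \<otimes>\<^sub>F snd p)) ((c \<otimes>\<^sub>F d) \<cdot> (fst q \<otimes>\<^sub>F snd q))
      = \<omega> (star (c * fst p) * (c * fst q)) * \<phi> (star (d * snd p) * (d * snd q))"
    if "p \<in> set xs" "q \<in> set xs" for p q
  proof -
    from xs that obtain S T S' T' where p: "homogeneous S T (fst p) (snd p)"
      and q: "homogeneous S' T' (fst q) (snd q)" by blast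
    have *: "inner ((c \<otimes>\<^sub>F d) \<cdot> (fst p \<otimes>\<^sub>F snd p)) ((c \<otimes>\<^sub>F d) \<cdot> (fst q \<otimes>\<^sub>F snd q))
      = fermi_sign t S * fermi_sign t S'
        * (\<omega> (star (c * fst p) * (c * fst q)) * \<phi> (star (d * snd p) * (d * snd q)))"
      by (simp add: mul_homogeneous[OF y p] mul_homogeneous[OF y q] inner.scale_left inner.scale_right
          inner_homogeneous[OF homogeneous_mult[OF y p] homogeneous_mult[OF y q]] cnj_fermi_sign)
    show ?thesis
    proof (cases "S = S'")
      case True
      with * show ?thesis by (simp add: fermi_sign_square)
    next
      case False
      then have "(s * S) * (s * S') = -1"
        using y p q by (auto simp: homogeneous_def)
      moreover have "has_grade \<alpha> ((s * S) * (s * S')) (star (c * fst p) * (c * fst q))"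
        using y p q unfolding homogeneous_def
        by (intro has_grade_mult[OF \<alpha>] has_grade_star[OF \<alpha>]) auto
      ultimately have "\<omega> (star (c * fst p) * (c * fst q)) = 0"
        by (intro even_functional_odd_element[OF even linear_\<omega>]) simp
      with * show ?thesis by simp
    qed
  qed
  ultimately show ?thesis
    by (simp add: inner.sum_list_both cong: map_cong)
qed

lemma inner_decomposed:
  assumes xs: "\<forall>p\<in>set xs. \<exists>s t. homogeneous s t (fst p) (snd p)"
    and x: "x = (\<Sum>p\<leftarrow>xs. fst p \<otimes>\<^sub>F snd p)"
  shows "inner x x = (\<Sum>p\<leftarrow>xs. \<Sum>q\<leftarrow>xs. \<omega> (star (fst p) * fst q) * \<phi> (star (snd p) * snd q))"
  using inner_translate[OF homogeneous_one xs] by (simp add: x mul_one_left)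

sublocale inner: positive_form inner
proof
  fix x
  obtain xs where "\<forall>p\<in>set xs. \<exists>s t. homogeneous s t (fst p) (snd p)"
    and "x = (\<Sum>p\<leftarrow>xs. fst p \<otimes>\<^sub>F snd p)"
    using homogeneous_decomposition[of x] by blast
  then show "0 \<le> inner x x"
    using schur_product[OF positive_form_of_functional[OF positive_\<omega>, of 1]
        positive_form_of_functional[OF positive_\<phi>, of 1], of xs]
    by (simp add: inner_decomposed)
qed

theorem product_positive: "positive_functional (fermi_mult \<alpha> \<beta>) (fermi_star \<alpha> \<beta>) (\<omega> \<times>\<^sub>f \<phi>)"
  using inner.nonneg
  by (simp add: positive_functional_def inner_def product_functional_linear[OF linear_\<omega> linear_\<phi>])

theorem product_contractive: "cmod ((\<omega> \<times>\<^sub>f \<phi>) x) \<le> sqrt (Re ((\<omega> \<times>\<^sub>f \<phi>) (adj x \<cdot> x)))"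
proof -
  have "inner (1 \<otimes>\<^sub>F 1) (1 \<otimes>\<^sub>F 1) = 1" "inner (1 \<otimes>\<^sub>F 1) x = (\<omega> \<times>\<^sub>f \<phi>) x"
    using state_\<omega> state_\<phi>
    by (simp_all add: inner_def adj_one mul_one_left product_functional_tensor[OF linear_\<omega> linear_\<phi>] state_def)
  then have "(cmod ((\<omega> \<times>\<^sub>f \<phi>) x))\<^sup>2 \<le> Re (inner x x)"
    using inner.cauchy_schwarz[of "1 \<otimes>\<^sub>F 1" x] by simp
  then show ?thesis by (simp add: real_le_rsqrt inner_def)
qed

lemma bounded_homogeneous:
  assumes y: "homogeneous s t c d" and "gns_bounded \<omega>" "gns_bounded \<phi>"
  shows "\<exists>C>0. \<forall>x. inner ((c \<otimes>\<^sub>F d) \<cdot> x) ((c \<otimes>\<^sub>F d) \<cdot> x) \<le> complex_of_real C * inner x x"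
proof -
  obtain C D where "C > 0" "D > 0"
    and C: "\<And>a. \<omega> (star a * star c * c * a) \<le> complex_of_real C * \<omega> (star a * a)"
    and D: "\<And>b. \<phi> (star b * star d * d * b) \<le> complex_of_real D * \<phi> (star b * b)"
    using assms(2,3) unfolding gns_bounded_def by blast
  have "inner ((c \<otimes>\<^sub>F d) \<cdot> x) ((c \<otimes>\<^sub>F d) \<cdot> x) \<le> complex_of_real (C * D) * inner x x" for x
  proof -
    obtain xs where xs: "\<forall>p\<in>set xs. \<exists>s t. homogeneous s t (fst p) (snd p)"
      and x: "x = (\<Sum>p\<leftarrow>xs. fst p \<otimes>\<^sub>F snd p)"
      using homogeneous_decomposition[of x] by blast
    show ?thesis
      unfolding inner_decomposed[OF xs x] unfolding x inner_translate[OF y xs]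
    proof (rule schur_product_mono)
      show "positive_form (\<lambda>u v. \<omega> (star u * v))"
        using positive_form_of_functional[OF positive_\<omega>, of 1] by simp
      show "positive_form (\<lambda>u v. \<phi> (star u * v))"
        using positive_form_of_functional[OF positive_\<phi>, of 1] by simp
      show "\<omega> (star (c * u) * (c * u)) \<le> complex_of_real C * \<omega> (star u * u)" for u
        using C[of u] by (simp add: star_mult mult.assoc)
      show "\<phi> (star (d * u) * (d * u)) \<le> complex_of_real D * \<phi> (star u * u)" for u
        using D[of u] by (simp add: star_mult mult.assoc)
      show "0 \<le> C" using \<open>C > 0\<close> by simp
    qed (rule positive_form_of_functional positive_\<omega> positive_\<phi>)+
  qed
  then show ?thesis using \<open>C > 0\<close> \<open>D > 0\<close> by (intro exI[of _ "C * D"]) simp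
qed

theorem product_bounded:
  assumes "gns_bounded \<omega>" "gns_bounded \<phi>"
  shows "\<exists>C>0. \<forall>x. (\<omega> \<times>\<^sub>f \<phi>) ((adj x \<cdot> adj y) \<cdot> (y \<cdot> x)) \<le> complex_of_real C * (\<omega> \<times>\<^sub>f \<phi>) (adj x \<cdot> x)"
proof -
  have "\<exists>C>0. \<forall>x. inner (y \<cdot> x) (y \<cdot> x) \<le> complex_of_real C * inner x x"
  proof (induction y rule: homogeneous_induct)
    case (homogeneous s t c d)
    then show ?case using assms by (rule bounded_homogeneous)
  next
    case (add y z)
    then obtain C D where "C > 0" "D > 0"
      and C: "\<And>x. inner (y \<cdot> x) (y \<cdot> x) \<le> complex_of_real C * inner x x"
      and D: "\<And>x. inner (z \<cdot> x) (z \<cdot> x) \<le> complex_of_real D * inner x x" by blast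
    have "inner ((y + z) \<cdot> x) ((y + z) \<cdot> x) \<le> complex_of_real (2 * C + 2 * D) * inner x x" for x
    proof -
      have "inner ((y + z) \<cdot> x) ((y + z) \<cdot> x) \<le> 2 * inner (y \<cdot> x) (y \<cdot> x) + 2 * inner (z \<cdot> x) (z \<cdot> x)"
        unfolding mul_add by (rule inner.diag_add_le)
      also have "\<dots> \<le> complex_of_real (2 * C + 2 * D) * inner x x"
        using C[of x] D[of x] by (simp add: less_eq_complex_def algebra_simps)
      finally show ?thesis .
    qed
    then show ?case using \<open>C > 0\<close> \<open>D > 0\<close> by (intro exI[of _ "2 * C + 2 * D"]) simp
  qed
  then show ?thesis by (simp add: inner_def adj_mul)
qed

end

section \<open>The general case\<close>

theorem proposition7p1:
  fixes \<alpha> :: "'a::complex_star_algebra \<Rightarrow> 'a" and \<beta> :: "'b::complex_star_algebra \<Rightarrow> 'b"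
    and \<omega> :: "'a \<Rightarrow> complex" and \<phi> :: "'b \<Rightarrow> complex"
  assumes "z2_grading \<alpha>" and "z2_grading \<beta>"
    and "state \<omega>" and "state \<phi>"
    and "even_functional \<alpha> \<omega> \<or> even_functional \<beta> \<phi>"
  shows "positive_functional (fermi_mult \<alpha> \<beta>) (fermi_star \<alpha> \<beta>) (\<omega> \<times>\<^sub>f \<phi>) \<and>
    (\<forall>x. cmod ((\<omega> \<times>\<^sub>f \<phi>) x) \<le> sqrt (Re ((\<omega> \<times>\<^sub>f \<phi>) (fermi_mult \<alpha> \<beta> (fermi_star \<alpha> \<beta> x) x)))) \<and>
    (gns_bounded \<omega> \<and> gns_bounded \<phi> \<longrightarrow>
      (\<forall>y. \<exists>C>0. \<forall>x.
        (\<omega> \<times>\<^sub>f \<phi>) (fermi_mult \<alpha> \<beta> (fermi_mult \<alpha> \<beta> (fermi_star \<alpha> \<beta> x) (fermi_star \<alpha> \<beta> y))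
                           (fermi_mult \<alpha> \<beta> y x))
        \<le> complex_of_real C * (\<omega> \<times>\<^sub>f \<phi>) (fermi_mult \<alpha> \<beta> (fermi_star \<alpha> \<beta> x) x)))"
proof (cases "even_functional \<alpha> \<omega>")
  case True
  interpret even_product \<alpha> \<beta> \<omega> \<phi>
    using assms True by unfold_locales
  show ?thesis
    using product_positive product_contractive product_bounded by blast
next
  \<comment> \<open>the flip reduces this case to the product functional \<open>\<phi> \<times>\<^sub>f \<omega>\<close>, whose first factor is even\<close>
  case False
  with assms have even: "even_functional \<beta> \<phi>" by blast
  interpret graded_pair \<alpha> \<beta>
    using assms by unfold_locales
  interpret flipped: even_product \<beta> \<alpha> \<phi> \<omega>
    using assms even by unfold_locales
  note flip = product_functional_flip[OF flipped.linear_\<phi> flipped.linear_\<omega> even] flip_mul flip_adj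
  have "positive_functional (fermi_mult \<alpha> \<beta>) (fermi_star \<alpha> \<beta>) (\<omega> \<times>\<^sub>f \<phi>)"
    using flipped.product_positive
    by (simp add: positive_functional_def product_functional_linear[OF flipped.linear_\<phi> flipped.linear_\<omega>] flip)
  moreover have "cmod ((\<omega> \<times>\<^sub>f \<phi>) x) \<le> sqrt (Re ((\<omega> \<times>\<^sub>f \<phi>) (fermi_mult \<alpha> \<beta> (fermi_star \<alpha> \<beta> x) x)))" for x
    unfolding flip by (rule flipped.product_contractive)
  moreover have "\<exists>C>0. \<forall>x.
        (\<omega> \<times>\<^sub>f \<phi>) (fermi_mult \<alpha> \<beta> (fermi_mult \<alpha> \<beta> (fermi_star \<alpha> \<beta> x) (fermi_star \<alpha> \<beta> y))
                           (fermi_mult \<alpha> \<beta> y x))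
        \<le> complex_of_real C * (\<omega> \<times>\<^sub>f \<phi>) (fermi_mult \<alpha> \<beta> (fermi_star \<alpha> \<beta> x) x)"
    if "gns_bounded \<omega>" "gns_bounded \<phi>" for y
    unfolding flip using flipped.product_bounded[OF that(2,1), of "fermi_flip \<alpha> \<beta> y"] by blast
  ultimately show ?thesis by blast
qed

end
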